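(* $$\prod_{n=1}^{\infty}\begin{bmatrix}\frac{n}{2(2n+1)} & -\frac{3}{2n(2n+1)} & 0 & \frac{3}{2n^{5}}-\frac{9H_{n-1}^{(4)}}{2n}\\ 0 & \frac{n}{2(2n+1)} & -\frac{3}{2n(2n+1)} & \frac{3}{2n^{3}}\\ 0 & 0 & \frac{n}{2(2n+1)} & \frac{3}{2n}\\ 0 & 0 & 0 & 1\end{bmatrix}=\begin{bmatrix}0 & 0 & 0 & \zeta(6)\\ 0 & 0 & 0 & \zeta(4)\\ 0 & 0 & 0 & \zeta(2)\\ 0 & 0 & 0 & 1\end{bmatrix}.$$
   Context: $\zeta(s)=\sum_{n\geqslant1}n^{-s}$ is the Riemann zeta function, and $H_{m}^{(4)}=\sum_{j=1}^{m}\frac{1}{j^4}$ with $H_0^{(4)}=0$. The infinite product $\prod_{n=1}^\infty \mathbf{M}_n$ of square matrices means the entrywise limit as $m\to\infty$ of the ordered products $\mathbf{M}_1\mathbf{M}_2\cdots\mathbf{M}_m$ (factors multiplied from left to right in increasing index). *)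

theory Defs
  imports "HOL-Analysis.Analysis"
begin

text \<open>The Dirichlet series; it represents the Riemann zeta function for \<open>s > 1\<close> only.\<close>

definition zeta :: "real \<Rightarrow> real" where
  "zeta s = (\<Sum>n. real (Suc n) powr (- s))"

definition gen_harm :: "nat \<Rightarrow> nat \<Rightarrow> real" where
  "gen_harm r m = (\<Sum>j=1..m. 1 / real j ^ r)"

primrec matrix_partial_prod :: "(nat \<Rightarrow> real ^ 'n ^ 'n) \<Rightarrow> nat \<Rightarrow> real ^ 'n ^ 'n" where
  "matrix_partial_prod M 0 = mat 1"
| "matrix_partial_prod M (Suc m) = matrix_partial_prod M m ** M (Suc m)"

definition has_matrix_prod :: "(nat \<Rightarrow> real ^ 'n ^ 'n) \<Rightarrow> real ^ 'n ^ 'n \<Rightarrow> bool" where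
  "has_matrix_prod M L \<longleftrightarrow>
     (\<forall>i j. (\<lambda>m. matrix_partial_prod M m $ i $ j) \<longlonglongrightarrow> L $ i $ j)"

end

theory Submission
  imports Defs "HOL-Real_Asymp.Real_Asymp"
begin

text \<open>
  Modulo \<open>X\<^sup>3\<close> the matrices encode multiplication by \<open>n/(2(2n+1)) \<cdot> (1 - 4X/n\<^sup>2)/(1 - X/n\<^sup>2)\<close>,
  up to the factor \<open>1 - 3 H\<^sub>n\<^sup>(\<^sup>4\<^sup>) X\<^sup>2\<close> that accounts for the difference between
  \<open>(1 - 4y)/(1 - y)\<close> and \<open>1 - 3y\<close>. Put
  \<open>S\<^sub>n = \<Sum>\<^sub>k\<^sub>\<ge>\<^sub>1 (\<Prod>m=1..n. m\<^sup>2 - X) / (\<Prod>j=0..n. (k+j)\<^sup>2 - X)\<close>, so that \<open>S\<^sub>0\<close> is the generating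
  function \<open>\<Sum>\<^sub>i \<zeta>(2i+2) X\<^sup>i\<close>. A telescoping argument in \<open>k\<close> gives
  \<open>2(2n-1)(n\<^sup>2 - X) S\<^sub>n\<^sub>-\<^sub>1 = n (n\<^sup>2 - 4X) S\<^sub>n + 3n\<close>, and the first three coefficients of
  \<open>(2n+1) S\<^sub>n\<close>, corrected by the factor above, form vectors \<open>v\<^sub>n\<close> with \<open>M\<^sub>n v\<^sub>n = v\<^sub>n\<^sub>-\<^sub>1\<close>.
  Hence \<open>M\<^sub>1 \<dots> M\<^sub>m v\<^sub>m = v\<^sub>0\<close>; since the first three columns of the product are
  \<open>O(m\<^sup>2 4\<^sup>-\<^sup>m)\<close> and \<open>v\<^sub>m\<close> grows polynomially, the last column converges to \<open>v\<^sub>0\<close>.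
\<close>

section \<open>Terms of the accelerated series as formal power series\<close>

unbundle no vec_syntax
unbundle fps_syntax

definition sq_minus_X :: "nat \<Rightarrow> real fps" where
  "sq_minus_X a = fps_const (real a ^ 2) - fps_X"

definition accel_term :: "nat \<Rightarrow> nat \<Rightarrow> real fps" where
  "accel_term n k = (\<Prod>m=1..n. sq_minus_X m) * (\<Prod>j=0..n. inverse (sq_minus_X (k + j)))"

lemma sq_minus_X_nonzero: "a \<noteq> 0 \<Longrightarrow> sq_minus_X a \<noteq> 0"
  by (auto simp: sq_minus_X_def fps_eq_iff intro!: exI[of _ 0])

lemma inverse_sq_minus_X: "a \<noteq> 0 \<Longrightarrow> inverse (sq_minus_X a) * sq_minus_X a = 1"
  by (rule inverse_mult_eq_1) (simp add: sq_minus_X_def)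

lemma sq_minus_X_mult_nth:
  "(f * sq_minus_X a) $ i = real a ^ 2 * f $ i - (if i = 0 then 0 else f $ (i - 1))"
  by (simp add: sq_minus_X_def right_diff_distrib mult.commute[of f])

lemma accel_term_0: "k \<noteq> 0 \<Longrightarrow> accel_term 0 k * sq_minus_X k = 1"
  by (simp add: accel_term_def inverse_sq_minus_X)

lemma accel_term_Suc:
  assumes "k \<noteq> 0"
  shows "accel_term (Suc n) k * sq_minus_X (k + Suc n) = accel_term n k * sq_minus_X (Suc n)"
proof -
  have "accel_term (Suc n) k = accel_term n k * sq_minus_X (Suc n) * inverse (sq_minus_X (k + Suc n))"
    by (simp add: accel_term_def mult_ac)
  then show ?thesis
    using inverse_sq_minus_X[of "k + Suc n"] by (simp add: mult.assoc)
qed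

text \<open>Passing from k to k+1 moves the window of n+1 denominator factors: k^2 - X leaves and
  (k+n+1)^2 - X enters, while the n factors \<open>Q\<close> in between are common to both.\<close>

lemma accel_term_shift:
  assumes "k \<noteq> 0"
  shows "accel_term n (Suc k) * sq_minus_X (k + Suc n) = accel_term n k * sq_minus_X k"
proof -
  define P where "P = (\<Prod>m=1..n. sq_minus_X m)"
  define Q where "Q = (\<Prod>j=1..n. inverse (sq_minus_X (k + j)))"
  have "(\<Prod>j=0..n. inverse (sq_minus_X (k + j))) = inverse (sq_minus_X k) * Q"
    unfolding Q_def by (subst prod.atLeast_Suc_atMost) simp_all
  then have *: "accel_term n k = P * Q * inverse (sq_minus_X k)"
    by (simp add: accel_term_def P_def mult_ac)
  have "(\<Prod>j=0..n. inverse (sq_minus_X (Suc k + j))) = (\<Prod>j=1..Suc n. inverse (sq_minus_X (k + j)))"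
    using prod.shift_bounds_cl_Suc_ivl[of "\<lambda>j. inverse (sq_minus_X (k + j))" 0 n] by simp
  then have "accel_term n (Suc k) = P * Q * inverse (sq_minus_X (k + Suc n))"
    by (simp add: accel_term_def P_def Q_def mult_ac)
  with * show ?thesis
    using assms inverse_sq_minus_X[of "k + Suc n"] inverse_sq_minus_X[of k]
    by (simp add: mult.assoc)
qed

text \<open>At k = 1 the numerator cancels every denominator factor except the last. This evaluates
  the boundary term of the telescoping sum over k.\<close>

lemma accel_term_one: "accel_term n 1 * sq_minus_X (Suc n) = 1"
proof -
  have "(\<Prod>j=0..n. inverse (sq_minus_X (1 + j))) = (\<Prod>j=1..Suc n. inverse (sq_minus_X j))"
    using prod.shift_bounds_cl_Suc_ivl[of "\<lambda>j. inverse (sq_minus_X j)" 0 n] by simp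
  then have "accel_term n 1 * sq_minus_X (Suc n)
      = (\<Prod>m=1..n. inverse (sq_minus_X m) * sq_minus_X m)
        * (inverse (sq_minus_X (Suc n)) * sq_minus_X (Suc n))"
    by (simp add: accel_term_def prod.distrib mult_ac)
  also have "\<dots> = 1"
    by (simp add: inverse_sq_minus_X)
  finally show ?thesis .
qed

section \<open>Coefficients of the terms: values and bounds\<close>

lemma accel_term_0_nth: "k \<noteq> 0 \<Longrightarrow> accel_term 0 k $ i = 1 / real k ^ (2 * i + 2)"
proof (induction i)
  case 0
  then show ?case
    using arg_cong[OF accel_term_0, of k "\<lambda>f. f $ 0"]
    by (simp add: sq_minus_X_def field_simps power2_eq_square)
next
  case (Suc i)
  have "real k ^ 2 * accel_term 0 k $ Suc i = accel_term 0 k $ i"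
    using arg_cong[OF accel_term_0[OF Suc.prems], of "\<lambda>f. f $ Suc i"]
    unfolding sq_minus_X_mult_nth by simp
  then have "accel_term 0 k $ Suc i = accel_term 0 k $ i / real k ^ 2"
    using Suc.prems by (simp add: eq_divide_eq mult.commute)
  then show ?case
    using Suc by (simp add: power_add[symmetric])
qed

text \<open>Comparing coefficients in \<open>accel_term_Suc\<close> controls coefficient i at level
  n+1 by coefficient i at level n and the two coefficients i-1 at both levels, hence the nested
  inductions. The decay 1/k^2 gives summability in k; the polynomial growth in n is later beaten by
  4^-m.\<close>

lemma accel_term_nth_bound:
  assumes "k \<noteq> 0"
  shows "\<bar>accel_term n k $ i\<bar> \<le> (2 * real n + 1) ^ i / real k ^ 2"
proof (induction n arbitrary: i)
  case 0
  have "real k ^ 2 \<le> real k ^ (2 * i + 2)"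
    using assms by (intro power_increasing) auto
  then show ?case
    using assms by (simp add: accel_term_0_nth divide_simps)
next
  case (Suc n)
  define p where "p = real (k + Suc n) ^ 2"
  define q where "q = real (Suc n) ^ 2"
  have pq: "1 \<le> p" "0 \<le> q" "q \<le> p"
    by (auto simp: p_def q_def power_mono)
  have rec: "p * accel_term (Suc n) k $ i = q * accel_term n k $ i
      + (if i = 0 then 0 else accel_term (Suc n) k $ (i - 1) - accel_term n k $ (i - 1))" for i
    using arg_cong[OF accel_term_Suc[OF assms], of "\<lambda>f. f $ i" n]
    by (auto simp: sq_minus_X_mult_nth p_def q_def)
  \<comment> \<open>Dividing by p costs nothing: q \<le> p absorbs the factor of z, and 1 \<le> p
    absorbs r.\<close>
  have step: "\<bar>y\<bar> \<le> \<bar>z\<bar> + \<bar>r\<bar>" if "p * y = q * z + r" for y z r :: real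
  proof -
    have "p * \<bar>y\<bar> = \<bar>q * z + r\<bar>"
      using pq that by (metis abs_mult abs_of_nonneg order_trans zero_le_one)
    also have "\<dots> \<le> q * \<bar>z\<bar> + \<bar>r\<bar>"
      using pq abs_triangle_ineq[of "q * z" r] by (simp add: abs_mult)
    also have "\<dots> \<le> p * \<bar>z\<bar> + p * \<bar>r\<bar>"
      using pq by (intro add_mono mult_right_mono) (auto intro: mult_right_mono[of 1 p, simplified])
    finally have "p * \<bar>y\<bar> \<le> p * (\<bar>z\<bar> + \<bar>r\<bar>)"
      by (simp add: distrib_left)
    then show ?thesis
      using pq by simp
  qed
  show ?case
  proof (induction i)
    case 0
    show ?case
      using step[OF rec[of 0]] Suc.IH[of 0] by simp
  next
    case (Suc i)
    define a where "a = 2 * real n + 1"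
    have a: "a \<ge> 0" "2 * real (Suc n) + 1 = a + 2"
      by (simp_all add: a_def)
    have "\<bar>accel_term (Suc n) k $ Suc i\<bar>
        \<le> \<bar>accel_term n k $ Suc i\<bar> + (\<bar>accel_term (Suc n) k $ i\<bar> + \<bar>accel_term n k $ i\<bar>)"
      using step[OF rec[of "Suc i"]] by simp
    also have "\<dots> \<le> a ^ Suc i / real k ^ 2 + ((a + 2) ^ i / real k ^ 2 + a ^ i / real k ^ 2)"
      using \<open>\<And>i. \<bar>accel_term n k $ i\<bar> \<le> (2 * real n + 1) ^ i / real k ^ 2\<close> Suc.IH
      unfolding a a_def[symmetric] by (intro add_mono)
    also have "\<dots> = (a * a ^ i + (a + 2) ^ i + a ^ i) / real k ^ 2"
      by (simp add: add_divide_distrib)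
    also have "\<dots> \<le> (a + 2) ^ Suc i / real k ^ 2"
    proof (intro divide_right_mono)
      \<comment> \<open>The first summand is at most a times (a+2)^i and the other two at most 2
        times (a+2)^i. This uses exactly the increment 2 of the base 2n+1.\<close>
      have *: "a ^ i \<le> (a + 2) ^ i"
        using a by (intro power_mono) auto
      then have "a * a ^ i \<le> a * (a + 2) ^ i"
        using a by (intro mult_left_mono) auto
      with * show "a * a ^ i + (a + 2) ^ i + a ^ i \<le> (a + 2) ^ Suc i"
        by (simp add: distrib_right)
    qed simp
    finally show ?case
      unfolding a .
  qed
qed

section \<open>Summation over k and the recurrence in n\<close>

lemma summable_inverse_Suc_squares: "summable (\<lambda>k. C / real (Suc k) ^ 2)"
proof -
  have "summable (\<lambda>k. inverse (real (Suc k) ^ 2))"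
    unfolding summable_Suc_iff[of "\<lambda>k. inverse (real k ^ 2)"] by (rule inverse_power_summable) simp
  from summable_mult[OF this, of C] show ?thesis
    by (simp only: divide_inverse)
qed

lemma accel_term_nth_summable: "summable (\<lambda>k. accel_term n (Suc k) $ i)"
  by (rule summable_comparison_test'[OF summable_inverse_Suc_squares[of "(2 * real n + 1) ^ i"]])
     (use accel_term_nth_bound[of "Suc _" n i] in simp)

text \<open>The series S_n is summed coefficientwise in the reals: its terms have nonzero constant
  coefficients, so it does not converge X-adically.\<close>

definition accel_sum :: "nat \<Rightarrow> real fps" where
  "accel_sum n = Abs_fps (\<lambda>i. \<Sum>k. accel_term n (Suc k) $ i)"

lemma accel_sum_nth_sums: "(\<lambda>k. accel_term n (Suc k) $ i) sums (accel_sum n $ i)"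
  using summable_sums[OF accel_term_nth_summable] by (simp add: accel_sum_def)

lemma accel_sum_0_nth: "accel_sum 0 $ i = zeta (real (2 * i + 2))"
proof -
  have "accel_term 0 (Suc k) $ i = real (Suc k) powr (- real (2 * i + 2))" for k
    unfolding accel_term_0_nth[OF Suc_not_Zero] powr_minus
    by (subst powr_realpow) (simp_all add: divide_inverse)
  then show ?thesis
    by (simp add: accel_sum_def zeta_def)
qed

lemma accel_sum_nth_bound:
  "\<bar>accel_sum n $ i\<bar> \<le> (2 * real n + 1) ^ i * (\<Sum>k. 1 / real (Suc k) ^ 2)"
proof -
  have "\<bar>accel_sum n $ i\<bar> \<le> (\<Sum>k. (2 * real n + 1) ^ i / real (Suc k) ^ 2)"
    unfolding accel_sum_def fps_nth_Abs_fps real_norm_def[symmetric]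
    by (rule norm_suminf_le[OF _ summable_inverse_Suc_squares])
       (use accel_term_nth_bound[of "Suc _" n i] in simp)
  also have "\<dots> = (2 * real n + 1) ^ i * (\<Sum>k. 1 / real (Suc k) ^ 2)"
    using suminf_mult[OF summable_inverse_Suc_squares[of 1], of "(2 * real n + 1) ^ i"] by simp
  finally show ?thesis .
qed

text \<open>A Wilf-Zeilberger style certificate: the combination of levels n and n+1 wanted for the
  recurrence is a difference in k of (2k+3n+1) \<open>accel_term n k\<close>, up to the factor
  \<open>sq_minus_X (Suc n)\<close>, which is free of k.\<close>

lemma accel_term_telescope:
  assumes "k \<noteq> 0"
  shows "fps_const (2 * (2 * real n + 1)) * (accel_term n k * sq_minus_X (Suc n))
      - fps_const (real (Suc n)) * (accel_term (Suc n) k * (fps_const (real (Suc n) ^ 2) - 4 * fps_X))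
    = (fps_const (2 * real k + 3 * real n + 1) * accel_term n k
       - fps_const (2 * real (Suc k) + 3 * real n + 1) * accel_term n (Suc k)) * sq_minus_X (Suc n)"
    (is "?L = ?R")
proof -
  let ?p = "sq_minus_X (k + Suc n)"
  have nz: "?p \<noteq> 0"
    by (intro sq_minus_X_nonzero) simp
  define x where "x = accel_term n k * sq_minus_X (Suc n)"
  define N where "N = fps_const (real n)"
  define K where "K = fps_const (real k)"
  have N: "fps_const (real (Suc n)) = N + 1" "fps_const (real (Suc n) ^ 2) = (N + 1) ^ 2"
    "fps_const (2 * (2 * real n + 1)) = 2 * (2 * N + 1)"
    "fps_const (2 * real k + 3 * real n + 1) = 2 * K + 3 * N + 1"
    "fps_const (2 * real (Suc k) + 3 * real n + 1) = 2 * K + 3 * N + 3"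
    by (simp_all add: N_def K_def power2_eq_square numeral_fps_const add_ac
        fps_const_add[symmetric] fps_const_mult[symmetric] del: fps_const_add fps_const_mult)
  have p: "?p = (K + N + 1) ^ 2 - fps_X" "sq_minus_X k = K ^ 2 - fps_X"
    by (simp_all add: sq_minus_X_def N_def K_def power2_eq_square algebra_simps)
  \<comment> \<open>After multiplication by \<open>?p\<close>, the relations
    \<open>accel_term_Suc\<close> and \<open>accel_term_shift\<close> make every term a multiple of
    \<open>x\<close>. What remains is a polynomial identity in K, N and X, and \<open>?p\<close> is
    cancelled at the end.\<close>
  have "?L * ?p = 2 * (2 * N + 1) * x * ?p
      - (N + 1) * ((N + 1) ^ 2 - 4 * fps_X) * (accel_term (Suc n) k * ?p)"
    unfolding N x_def by (simp add: algebra_simps)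
  also have "\<dots> = (2 * (2 * N + 1) * ?p - (N + 1) * ((N + 1) ^ 2 - 4 * fps_X)) * x"
    unfolding accel_term_Suc[OF assms] x_def by (simp add: algebra_simps)
  also have "\<dots> = ((2 * K + 3 * N + 1) * ?p - (2 * K + 3 * N + 3) * sq_minus_X k) * x"
    unfolding p by (simp add: algebra_simps power2_eq_square)
  also have "\<dots> = ((2 * K + 3 * N + 1) * ?p * accel_term n k
      - (2 * K + 3 * N + 3) * (accel_term n (Suc k) * ?p)) * sq_minus_X (Suc n)"
    unfolding accel_term_shift[OF assms] x_def by (simp add: algebra_simps)
  also have "\<dots> = ?R * ?p"
    unfolding N by (simp add: algebra_simps)
  finally show ?thesis
    using nz by simp
qed


lemma accel_sum_rec_nth:
  "2 * (2 * real n + 1) * (accel_sum n * sq_minus_X (Suc n)) $ i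
    = real (Suc n) * (accel_sum (Suc n) * (fps_const (real (Suc n) ^ 2) - 4 * fps_X)) $ i
      + (if i = 0 then 3 * real (Suc n) else 0)"
proof -
  have mult4: "(f * (fps_const c - 4 * fps_X)) $ i = c * f $ i - 4 * (if i = 0 then 0 else f $ (i - 1))"
    for f :: "real fps" and c i
    by (simp add: right_diff_distrib mult.commute[of f] mult.assoc numeral_fps_const)
  define g where "g k = fps_const (2 * real k + 3 * real n + 1) * accel_term n k" for k
  \<comment> \<open>The linear factor in k loses against the decay 1/k^2, so the telescoping sum has
    no contribution from infinity.\<close>
  have g_lim: "(\<lambda>k. g (Suc k) $ i) \<longlonglongrightarrow> 0" for i
  proof (rule Lim_null_comparison)
    have "norm (g (Suc k) $ i)
        \<le> (2 * real (Suc k) + 3 * real n + 1) * ((2 * real n + 1) ^ i / real (Suc k) ^ 2)" for k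
      unfolding g_def fps_mult_left_const_nth norm_mult
      using accel_term_nth_bound[of "Suc k" n i] by (intro mult_mono) auto
    then show "\<forall>\<^sub>F k in sequentially. norm (g (Suc k) $ i)
        \<le> (2 * real (Suc k) + 3 * real n + 1) * ((2 * real n + 1) ^ i / real (Suc k) ^ 2)"
      by simp
    show "(\<lambda>k. (2 * real (Suc k) + 3 * real n + 1) * ((2 * real n + 1) ^ i / real (Suc k) ^ 2))
        \<longlonglongrightarrow> 0"
      by real_asymp
  qed
  have tel: "2 * (2 * real n + 1) * (accel_term n (Suc k) * sq_minus_X (Suc n)) $ i
      - real (Suc n) * (accel_term (Suc n) (Suc k) * (fps_const (real (Suc n) ^ 2) - 4 * fps_X)) $ i
      = (g (Suc k) * sq_minus_X (Suc n)) $ i - (g (Suc (Suc k)) * sq_minus_X (Suc n)) $ i" for k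
    using arg_cong[OF accel_term_telescope[of "Suc k" n], of "\<lambda>f. f $ i"]
    by (simp only: g_def fps_sub_nth fps_mult_left_const_nth left_diff_distrib not_False_eq_True Suc_not_Zero)
  have "(\<lambda>k. (g (Suc k) * sq_minus_X (Suc n)) $ i) \<longlonglongrightarrow> real (Suc n) ^ 2 * 0 - 0"
    unfolding sq_minus_X_mult_nth
    by (intro tendsto_diff tendsto_mult tendsto_const g_lim) (cases i; simp add: g_lim)
  then have sum_g: "(\<lambda>k. (g (Suc k) * sq_minus_X (Suc n)) $ i - (g (Suc (Suc k)) * sq_minus_X (Suc n)) $ i)
      sums ((g (Suc 0) * sq_minus_X (Suc n)) $ i - 0)"
    by (intro telescope_sums') simp
  \<comment> \<open>At k = 1 the factor 2k+3n+1 equals 3(n+1). This constant series is the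
    inhomogeneous term, visible only in coefficient 0.\<close>
  have g_one: "g (Suc 0) * sq_minus_X (Suc n) = fps_const (3 * real (Suc n))"
    using accel_term_one[of n] by (simp add: g_def mult.assoc algebra_simps)
  have "(\<lambda>k. (accel_term n (Suc k) * sq_minus_X (Suc n)) $ i)
      sums ((accel_sum n * sq_minus_X (Suc n)) $ i)"
    unfolding sq_minus_X_mult_nth
    by (cases i) (auto intro!: sums_diff sums_mult accel_sum_nth_sums)
  moreover have "(\<lambda>k. (accel_term (Suc n) (Suc k) * (fps_const (real (Suc n) ^ 2) - 4 * fps_X)) $ i)
      sums ((accel_sum (Suc n) * (fps_const (real (Suc n) ^ 2) - 4 * fps_X)) $ i)"
    unfolding mult4
    by (cases i) (auto intro!: sums_diff sums_mult accel_sum_nth_sums)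
  ultimately have "(\<lambda>k. (g (Suc k) * sq_minus_X (Suc n)) $ i - (g (Suc (Suc k)) * sq_minus_X (Suc n)) $ i)
      sums (2 * (2 * real n + 1) * (accel_sum n * sq_minus_X (Suc n)) $ i
        - real (Suc n) * (accel_sum (Suc n) * (fps_const (real (Suc n) ^ 2) - 4 * fps_X)) $ i)"
    unfolding tel[symmetric] by (intro sums_diff sums_mult)
  from sums_unique2[OF this sum_g] show ?thesis
    unfolding g_one fps_nth_fps_const by (simp only: diff_zero diff_eq_eq add.commute)
qed

section \<open>Scaled coefficients: recurrences and growth\<close>

definition tail_coeff :: "nat \<Rightarrow> nat \<Rightarrow> real" where
  "tail_coeff i n = (2 * real n + 1) * accel_sum n $ i"

text \<open>The scaling by 2n+1 absorbs the 2n-1 on the left of the recurrence for S_n and puts 2n+1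
  into the denominator on the right, which produces the diagonal entry n/(2(2n+1)). The rest is
  comparison of coefficients, divided by n^2.\<close>

lemma tail_coeff_rec:
  assumes "n \<noteq> 0"
  shows "tail_coeff 0 (n - 1) = real n / (2 * (2 * real n + 1)) * tail_coeff 0 n + 3 / (2 * real n)"
    and "tail_coeff (Suc i) (n - 1) = real n / (2 * (2 * real n + 1))
      * (tail_coeff (Suc i) n - 4 * tail_coeff i n / real n ^ 2) + tail_coeff i (n - 1) / real n ^ 2"
proof -
  obtain m where n: "n = Suc m"
    using assms by (cases n) auto
  define c where "c = real n / (2 * (2 * real n + 1))"
  have c: "real n * accel_sum n $ i = 2 * c * tail_coeff i n" for i
  proof -
    have "2 * c * (2 * real n + 1) = real n"
      by (simp add: c_def field_simps)
    then show ?thesis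
      by (simp add: tail_coeff_def mult.assoc[symmetric])
  qed
  have d: "(2 * real m + 1) * accel_sum m $ i = tail_coeff i (n - 1)" for i
    by (simp add: tail_coeff_def n)
  have "2 * (real n ^ 2 * ((2 * real m + 1) * accel_sum m $ 0))
      = real n ^ 2 * (real n * accel_sum n $ 0) + 3 * real n"
    using accel_sum_rec_nth[of m 0] by (simp add: sq_minus_X_def n numeral_fps_const algebra_simps)
  then have r0: "real n ^ 2 * tail_coeff 0 (n - 1) = real n ^ 2 * (c * tail_coeff 0 n) + 3 / 2 * real n"
    unfolding c d by simp
  have cancel: "x = y + z / real n ^ 2" if "real n ^ 2 * x = real n ^ 2 * y + z" for x y z
    using that assms by (simp add: field_simps)
  show "tail_coeff 0 (n - 1) = real n / (2 * (2 * real n + 1)) * tail_coeff 0 n + 3 / (2 * real n)"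
    using cancel[OF r0] assms
    by (simp add: c_def power2_eq_square)
  have mult4: "(f * (fps_const c - 4 * fps_X)) $ Suc i = c * f $ Suc i - 4 * f $ i"
    for f :: "real fps" and c
    by (simp add: right_diff_distrib mult.commute[of f] mult.assoc numeral_fps_const)
  have "2 * (real n ^ 2 * ((2 * real m + 1) * accel_sum m $ Suc i) - (2 * real m + 1) * accel_sum m $ i)
      = real n ^ 2 * (real n * accel_sum n $ Suc i) - 4 * (real n * accel_sum n $ i)"
    using accel_sum_rec_nth[of m "Suc i"] unfolding mult4 sq_minus_X_mult_nth n[symmetric]
    by (simp add: algebra_simps)
  then have "real n ^ 2 * tail_coeff (Suc i) (n - 1)
      = real n ^ 2 * (c * tail_coeff (Suc i) n) + (tail_coeff i (n - 1) - 4 * (c * tail_coeff i n))"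
    unfolding c d by simp
  from cancel[OF this] show "tail_coeff (Suc i) (n - 1) = real n / (2 * (2 * real n + 1))
      * (tail_coeff (Suc i) n - 4 * tail_coeff i n / real n ^ 2) + tail_coeff i (n - 1) / real n ^ 2"
    unfolding c_def[symmetric] by (simp add: right_diff_distrib diff_divide_distrib)
qed

lemma tail_coeff_bound:
  "\<bar>tail_coeff i n\<bar> \<le> (2 * real n + 1) ^ Suc i * (\<Sum>k. 1 / real (Suc k) ^ 2)"
  using mult_left_mono[OF accel_sum_nth_bound[of n i], of "2 * real n + 1"]
  by (simp add: tail_coeff_def abs_mult mult.assoc)

lemma gen_harm_bound: "\<bar>gen_harm r m\<bar> \<le> real m"
proof -
  have "\<bar>gen_harm r m\<bar> \<le> (\<Sum>j=1..m. \<bar>1 / real j ^ r\<bar>)"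
    unfolding gen_harm_def by (rule sum_abs)
  also have "\<dots> \<le> (\<Sum>j=1..m. 1)"
    by (intro sum_mono) (auto simp: divide_simps)
  finally show ?thesis
    by simp
qed

section \<open>The matrix product\<close>

unbundle no fps_syntax
unbundle vec_syntax

lemma vector_4 [simp]:
  "(vector [a, b, c, d] :: 'a::zero ^ 4) $ 1 = a"
  "(vector [a, b, c, d] :: 'a::zero ^ 4) $ 2 = b"
  "(vector [a, b, c, d] :: 'a::zero ^ 4) $ 3 = c"
  "(vector [a, b, c, d] :: 'a::zero ^ 4) $ 4 = d"
  unfolding vector_def by simp_all

lemma matrix_partial_prod_tail:
  fixes M :: "nat \<Rightarrow> real ^ 'n ^ 'n"
  assumes "\<And>n. n \<ge> 1 \<Longrightarrow> M n *v v n = v (n - 1)"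
  shows "matrix_partial_prod M m *v v m = v 0"
  by (induction m) (simp_all add: matrix_vector_mul_assoc[symmetric] assms)

theorem theorem6p3:
  shows "has_matrix_prod
    (\<lambda>n. vector
      [vector [real n / (2 * (2 * real n + 1)), - (3 / (2 * real n * (2 * real n + 1))), 0,
               3 / (2 * real n ^ 5) - 9 * gen_harm 4 (n - 1) / (2 * real n)],
       vector [0, real n / (2 * (2 * real n + 1)), - (3 / (2 * real n * (2 * real n + 1))),
               3 / (2 * real n ^ 3)],
       vector [0, 0, real n / (2 * (2 * real n + 1)), 3 / (2 * real n)],
       vector [0, 0, 0, 1]] :: real ^ 4 ^ 4)
    (vector
      [vector [0, 0, 0, zeta 6],
       vector [0, 0, 0, zeta 4],
       vector [0, 0, 0, zeta 2],
       vector [0, 0, 0, 1]])"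
    (is "has_matrix_prod ?M ?L")
proof -
  define M where "M = ?M"
  define P where "P = matrix_partial_prod M"
  define a where "a n = real n / (2 * (2 * real n + 1))" for n
  define b where "b n = - (3 / (2 * real n * (2 * real n + 1)))" for n
  have M_eq: "M n = vector
      [vector [a n, b n, 0, 3 / (2 * real n ^ 5) - 9 * gen_harm 4 (n - 1) / (2 * real n)],
       vector [0, a n, b n, 3 / (2 * real n ^ 3)],
       vector [0, 0, a n, 3 / (2 * real n)],
       vector [0, 0, 0, 1]]" for n
    by (simp only: M_def a_def b_def)
  define v :: "nat \<Rightarrow> real ^ 4" where
    "v n = vector [tail_coeff 2 n - 3 * gen_harm 4 n * tail_coeff 0 n,
                   tail_coeff 1 n, tail_coeff 0 n, 1]" for n

  have "M n *v v n = v (n - 1)" if "n \<ge> 1" for n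
  proof -
    have n: "n \<noteq> 0" "real n \<noteq> 0"
      using that by auto
    have ba: "b n = - 3 * a n / real n ^ 2"
      using n by (simp add: a_def b_def power2_eq_square)
    have harm: "gen_harm 4 n = gen_harm 4 (n - 1) + 1 / real n ^ 4"
      using that by (cases n) (simp_all add: gen_harm_def)
    note rec = tail_coeff_rec[OF n(1), folded a_def]
    have rec0: "tail_coeff 0 (n - 1) = a n * tail_coeff 0 n + 3 / (2 * real n)"
      by (rule rec(1))
    \<comment> \<open>Substituting the recurrence for index 0 combines the contributions -4 and +1
      of a(n) T_0(n)/n^2, where T_i is \<open>tail_coeff i\<close>, into -3, which is the entry
      \<open>b n\<close>.\<close>
    have rec1: "tail_coeff 1 (n - 1) = a n * tail_coeff 1 n + b n * tail_coeff 0 n + 3 / (2 * real n ^ 3)"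
    proof -
      have "c * (x - 4 * y / r ^ 2) + (c * y + 3 / (2 * r)) / r ^ 2
          = c * x + - 3 * c / r ^ 2 * y + 3 / (2 * r ^ 3)" if "r \<noteq> 0" for c x y r :: real
        using that by (simp add: field_simps eval_nat_numeral)
      from this[OF n(2)] show ?thesis
        using rec(2)[of 0, folded One_nat_def] unfolding rec0 ba by (rule trans[rotated])
    qed
    \<comment> \<open>The extra term in 1/n^4 reflects (1-4y)/(1-y) = 1 - 3y - 3y^2 - ... with y =
      X/n^2. The zero entry in row 1, column 3 of the matrix does not supply it.\<close>
    have rec2: "tail_coeff 2 (n - 1) = a n * tail_coeff 2 n + b n * tail_coeff 1 n
        - 3 * a n * tail_coeff 0 n / real n ^ 4 + 3 / (2 * real n ^ 5)"
    proof -
      have "c * (x - 4 * y / r ^ 2) + (c * y + - 3 * c / r ^ 2 * z + 3 / (2 * r ^ 3)) / r ^ 2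
          = c * x + - 3 * c / r ^ 2 * y - 3 * c * z / r ^ 4 + 3 / (2 * r ^ 5)"
        if "r \<noteq> 0" for c x y z r :: real
        using that by (simp add: field_simps eval_nat_numeral)
      from this[OF n(2)] show ?thesis
        using rec(2)[of 1] unfolding rec1 ba Suc_1 by (rule trans[rotated])
    qed
    \<comment> \<open>The increment 1/n^4 of the harmonic sum accounts for that extra term. The
      remaining 3 \<open>gen_harm 4 (n - 1)\<close> times the inhomogeneous 3/(2n) is the harmonic
      part of the last matrix column.\<close>
    have "a n * (tail_coeff 2 n - 3 * gen_harm 4 n * tail_coeff 0 n) + b n * tail_coeff 1 n
        + (3 / (2 * real n ^ 5) - 9 * gen_harm 4 (n - 1) / (2 * real n))
        = tail_coeff 2 (n - 1) - 3 * gen_harm 4 (n - 1) * tail_coeff 0 (n - 1)"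
      unfolding rec2 rec0 harm by (simp add: algebra_simps)
    with rec0[symmetric] rec1[symmetric] show ?thesis
      by (simp only: M_eq v_def vec_eq_iff forall_4 matrix_vector_mult_def sum_4 vec_lambda_beta vector_4
          mult_zero_left add_0_left add_0_right mult_1_right simp_thms)
  qed
  then have Pv: "P m *v v m = v 0" for m
    unfolding P_def by (rule matrix_partial_prod_tail)

  \<comment> \<open>The last row of each factor vanishes in columns 1 to 3, so these columns evolve
    without the fourth, by the same recursion in every row i.\<close>
  have P_Suc: "P (Suc m) $ i $ 1 = P m $ i $ 1 * a (Suc m)"
      "P (Suc m) $ i $ 2 = P m $ i $ 1 * b (Suc m) + P m $ i $ 2 * a (Suc m)"
      "P (Suc m) $ i $ 3 = P m $ i $ 2 * b (Suc m) + P m $ i $ 3 * a (Suc m)" for m i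
    by (simp_all add: P_def matrix_matrix_mult_def sum_4 M_eq)
  \<comment> \<open>The bound 3/4 is written as 3 times 1/4, so that each superdiagonal step keeps
    the power of 1/4 and only adds to a polynomial in m.\<close>
  have ab: "\<bar>a (Suc m)\<bar> \<le> 1 / 4" "\<bar>b (Suc m)\<bar> \<le> 3 / 4" for m
  proof -
    show "\<bar>a (Suc m)\<bar> \<le> 1 / 4"
      by (simp add: a_def divide_simps)
    have "4 \<le> 2 * real (Suc m) * (2 * real (Suc m) + 1)"
      by (simp add: algebra_simps)
    then show "\<bar>b (Suc m)\<bar> \<le> 3 / 4"
      unfolding b_def by (simp add: divide_simps)
  qed
  have P_bound: "\<bar>P m $ i $ 1\<bar> \<le> (1 / 4) ^ m \<and> \<bar>P m $ i $ 2\<bar> \<le> (3 * real m + 1) * (1 / 4) ^ m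
      \<and> \<bar>P m $ i $ 3\<bar> \<le> (3 * real m + 1) ^ 2 * (1 / 4) ^ m" for m i
  proof (induction m)
    case 0
    show ?case
      by (simp add: P_def mat_def)
  next
    case (Suc m)
    define q :: real where "q = (1 / 4) ^ m"
    have q: "q \<ge> 0"
      by (simp add: q_def)
    have le: "\<bar>x * s\<bar> \<le> X * S" if "\<bar>x\<bar> \<le> X" "\<bar>s\<bar> \<le> S" for x s X S :: real
      using that by (simp add: abs_mult mult_mono')
    note IH = Suc.IH[folded q_def]
    have 1: "\<bar>P (Suc m) $ i $ 1\<bar> \<le> q * (1 / 4)"
      unfolding P_Suc using IH ab by (intro le) auto
    have "\<bar>P (Suc m) $ i $ 2\<bar> \<le> q * (3 / 4) + (3 * real m + 1) * q * (1 / 4)"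
      unfolding P_Suc using IH ab by (intro order_trans[OF abs_triangle_ineq] add_mono le) auto
    also have "\<dots> = (3 * real (Suc m) + 1) * (q * (1 / 4))"
      by (simp add: algebra_simps)
    finally have 2: "\<bar>P (Suc m) $ i $ 2\<bar> \<le> (3 * real (Suc m) + 1) * (q * (1 / 4))" .
    have "\<bar>P (Suc m) $ i $ 3\<bar> \<le> (3 * real m + 1) * q * (3 / 4) + (3 * real m + 1) ^ 2 * q * (1 / 4)"
      unfolding P_Suc using IH ab by (intro order_trans[OF abs_triangle_ineq] add_mono le) auto
    also have "\<dots> = ((3 * real m + 1) * 3 + (3 * real m + 1) ^ 2) * (q * (1 / 4))"
      by (simp add: algebra_simps)
    also have "\<dots> \<le> (3 * real (Suc m) + 1) ^ 2 * (q * (1 / 4))"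
      using q by (intro mult_right_mono) (auto simp: power2_eq_square algebra_simps)
    finally have 3: "\<bar>P (Suc m) $ i $ 3\<bar> \<le> (3 * real (Suc m) + 1) ^ 2 * (q * (1 / 4))" .
    show ?case
      using 1 2 3 by (simp add: q_def mult_ac)
  qed

  define Z where "Z = (\<Sum>k. 1 / real (Suc k) ^ 2)"
  have Z: "Z \<ge> 0"
    unfolding Z_def by (rule suminf_nonneg[OF summable_inverse_Suc_squares]) simp
  have P3: "\<bar>P m $ i $ j\<bar> \<le> (3 * real m + 1) ^ 2 * (1 / 4) ^ m" if j: "j \<noteq> 4" for m i j
  proof -
    have "1 \<le> 3 * real m + 1" "3 * real m + 1 \<le> (3 * real m + 1) ^ 2"
      by (simp_all add: power2_eq_square algebra_simps)
    then have s: "1 \<le> (3 * real m + 1) ^ 2" "3 * real m + 1 \<le> (3 * real m + 1) ^ 2"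
      by linarith+
    have q: "(0 :: real) \<le> (1 / 4) ^ m"
      by simp
    note P = P_bound[of m i]
    consider "j = 1" | "j = 2" | "j = 3"
      using exhaust_4[of j] j by blast
    then show ?thesis
    proof cases
      case 1
      show ?thesis
        unfolding 1 by (rule order_trans[OF conjunct1[OF P]]) (use mult_right_mono[OF s(1) q] in simp)
    next
      case 2
      show ?thesis
        unfolding 2
        by (rule order_trans[OF conjunct1[OF conjunct2[OF P]] mult_right_mono[OF s(2) q]])
    next
      case 3
      show ?thesis
        unfolding 3 by (rule conjunct2[OF conjunct2[OF P]])
    qed
  qed
  \<comment> \<open>The worst component is the first: 3 times a harmonic sum of size at most s times
    s Z, plus s^3 Z from \<open>tail_coeff 2\<close>. This gives the constant 4 and the degree
    3.\<close>
  have v_bound: "\<bar>v m $ j\<bar> \<le> (2 * real m + 1) ^ 3 * (4 * Z)" if "j \<noteq> 4" for m j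
  proof -
    define s where "s = 2 * real m + 1"
    have s: "1 \<le> s" "s \<le> s ^ 3" "s ^ 2 \<le> s ^ 3"
      using power_increasing[of 1 3 s] power_increasing[of 2 3 s] by (auto simp: s_def)
    have t: "\<bar>tail_coeff i m\<bar> \<le> s ^ Suc i * Z" for i
      using tail_coeff_bound[of i m] by (simp add: s_def Z_def)
    have sZ: "s * Z \<le> s ^ 3 * Z" "s ^ 2 * Z \<le> s ^ 3 * Z" "0 \<le> s ^ 3 * Z"
      using s Z by (auto intro!: mult_right_mono)
    have "\<bar>gen_harm 4 m * tail_coeff 0 m\<bar> \<le> s * (s * Z)"
      unfolding abs_mult using gen_harm_bound[of 4 m] t[of 0] s Z
      by (intro mult_mono) (auto simp: s_def)
    then have "\<bar>gen_harm 4 m * tail_coeff 0 m\<bar> \<le> s ^ 3 * Z"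
      using sZ by (simp add: power2_eq_square mult.assoc)
    moreover have "\<bar>tail_coeff 0 m\<bar> \<le> s ^ 3 * Z" "\<bar>tail_coeff 1 m\<bar> \<le> s ^ 3 * Z"
        "\<bar>tail_coeff 2 m\<bar> \<le> s ^ 3 * Z"
      using t[of 0] t[of 1] t[of 2] sZ by (simp_all add: numeral_2_eq_2 numeral_3_eq_3)
    ultimately have "\<bar>v m $ j\<bar> \<le> 4 * (s ^ 3 * Z)"
      using exhaust_4[of j] that sZ(3) by (auto simp: v_def)
    then show ?thesis
      by (simp add: s_def mult_ac)
  qed
  have P_lim: "(\<lambda>m. P m $ i $ j) \<longlonglongrightarrow> 0" if "j \<noteq> 4" for i j
  proof (rule Lim_null_comparison[OF always_eventually])
    show "\<forall>m. norm (P m $ i $ j) \<le> (3 * real m + 1) ^ 2 * (1 / 4) ^ m"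
      using P3[OF that] by simp
    show "(\<lambda>m. (3 * real m + 1) ^ 2 * (1 / 4) ^ m) \<longlonglongrightarrow> 0"
      by real_asymp
  qed
  have Pv_lim: "(\<lambda>m. P m $ i $ j * v m $ j) \<longlonglongrightarrow> 0" if "j \<noteq> 4" for i j
  proof (rule Lim_null_comparison[OF always_eventually])
    show "\<forall>m. norm (P m $ i $ j * v m $ j)
        \<le> (3 * real m + 1) ^ 2 * (1 / 4) ^ m * ((2 * real m + 1) ^ 3 * (4 * Z))"
      unfolding real_norm_def abs_mult
      by (intro allI mult_mono' P3[OF that] v_bound[OF that] abs_ge_zero)
    show "(\<lambda>m. (3 * real m + 1) ^ 2 * (1 / 4) ^ m * ((2 * real m + 1) ^ 3 * (4 * Z))) \<longlonglongrightarrow> 0"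
      by real_asymp
  qed
  have P4_lim: "(\<lambda>m. P m $ i $ 4) \<longlonglongrightarrow> v 0 $ i" for i
  proof -
    \<comment> \<open>The fourth component of \<open>v m\<close> is 1, so row i of \<open>Pv\<close>
      can be solved for the last entry.\<close>
    have "P m $ i $ 4 = v 0 $ i - P m $ i $ 1 * v m $ 1 - P m $ i $ 2 * v m $ 2 - P m $ i $ 3 * v m $ 3" for m
      using arg_cong[OF Pv[of m], of "\<lambda>x. x $ i"]
      by (simp add: matrix_vector_mult_def sum_4 v_def[of m])
    moreover have "(\<lambda>m. v 0 $ i - P m $ i $ 1 * v m $ 1 - P m $ i $ 2 * v m $ 2 - P m $ i $ 3 * v m $ 3)
        \<longlonglongrightarrow> v 0 $ i - 0 - 0 - 0"
      by (intro tendsto_diff tendsto_const Pv_lim) auto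
    ultimately show ?thesis
      by simp
  qed
  \<comment> \<open>At n = 0 the scaling factor is 1 and the harmonic sum is empty, so the
    coefficients of S_0 remain.\<close>
  have "v 0 = vector [zeta 6, zeta 4, zeta 2, 1]"
    by (simp add: v_def tail_coeff_def accel_sum_0_nth gen_harm_def)
  then show ?thesis
    using P4_lim[of 1] P4_lim[of 2] P4_lim[of 3] P4_lim[of 4] P_lim[of 1] P_lim[of 2] P_lim[of 3]
    unfolding has_matrix_prod_def M_def[symmetric] P_def[symmetric]
    by (simp add: forall_4)
qed

end
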